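(* Let $m\ge 3$ and let $G$ be a bicyclic graph with $2m$ vertices and matching number $m$. Then \[ \chi(G)\ge\frac{m+1}{\sqrt{m+4}}+\frac{1}{\sqrt{m+3}}+\frac{m-3}{\sqrt{3}}+1 \] with equality if and only if $G=B_{2m,m}$.
   Context: All graphs are simple. For a graph $G$, $d_G(u)$ is the degree of $u$. The sum--connectivity index is $\chi(G)=\sum_{uv\in E(G)}\frac{1}{\sqrt{d_G(u)+d_G(v)}}$. A bicyclic graph is a connected graph with $n$ vertices and $n+1$ edges. The matching number is the maximum number of pairwise vertex-disjoint edges. For $3\le m\le\lfloor n/2\rfloor$, $B_{n,m}$ is the graph obtained by identifying one vertex of each of two triangles (giving a common vertex $c$), then attaching to $c$ exactly $n-2m+1$ pendent vertices (each joined to $c$ by an edge) and $m-3$ paths on two vertices (each path joined to $c$ by an edge from one of its end vertices). $B_{n,m}$ has $n$ vertices and matching number $m$. *)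

theory Defs
  imports Complex_Main "HOL-Library.Disjoint_Sets"
begin

text \<open>A finite simple graph is given by its vertex set and a set of two-element edges.\<close>

definition simple_graph :: "'a set \<Rightarrow> 'a set set \<Rightarrow> bool" where
  "simple_graph V E \<longleftrightarrow> finite V \<and> (\<forall>e\<in>E. e \<subseteq> V \<and> card e = 2)"

definition degree :: "'a set set \<Rightarrow> 'a \<Rightarrow> nat" where
  "degree E v = card {e \<in> E. v \<in> e}"

definition connected_graph :: "'a set \<Rightarrow> 'a set set \<Rightarrow> bool" where
  "connected_graph V E \<longleftrightarrow>
     V \<noteq> {} \<and> (\<forall>u\<in>V. \<forall>v\<in>V. (u, v) \<in> {(x, y). {x, y} \<in> E}\<^sup>*)"

definition bicyclic :: "'a set \<Rightarrow> 'a set set \<Rightarrow> bool" where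
  "bicyclic V E \<longleftrightarrow> simple_graph V E \<and> connected_graph V E \<and> card E = card V + 1"

text \<open>For an edge \<open>e = {u, v}\<close> with \<open>u \<noteq> v\<close>, the inner sum is \<open>d(u) + d(v)\<close>.\<close>

definition sum_connectivity :: "'a set set \<Rightarrow> real" where
  "sum_connectivity E = (\<Sum>e\<in>E. 1 / sqrt (real (\<Sum>w\<in>e. degree E w)))"

definition is_matching :: "'a set set \<Rightarrow> 'a set set \<Rightarrow> bool" where
  "is_matching E M \<longleftrightarrow> M \<subseteq> E \<and> disjoint M"

definition matching_number :: "'a set set \<Rightarrow> nat" where
  "matching_number E = Max {card M | M. is_matching E M}"

definition graph_iso ::
  "'a set \<Rightarrow> 'a set set \<Rightarrow> 'b set \<Rightarrow> 'b set set \<Rightarrow> bool" where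
  "graph_iso V E V' E' \<longleftrightarrow>
     (\<exists>f. bij_betw f V V' \<and>
          (\<forall>u\<in>V. \<forall>v\<in>V. {u, v} \<in> E \<longleftrightarrow> {f u, f v} \<in> E'))"

text \<open>
  The graph \<open>B(n, m)\<close>, meaningful for \<open>3 \<le> m \<le> n div 2\<close>. \<open>Centre\<close> is the common vertex of
  the two triangles, whose other vertices are \<open>Tri i False\<close> and \<open>Tri i True\<close>, with \<open>i\<close> naming
  the triangle. The \<open>Pendent k\<close> are the pendent vertices at the centre, and
  \<open>Near k\<close>, \<open>Far k\<close> are the vertices of the attached paths on two vertices.
\<close>

datatype bvertex = Centre | Tri bool bool | Pendent nat | Near nat | Far nat

definition B_verts :: "nat \<Rightarrow> nat \<Rightarrow> bvertex set" where
  "B_verts n m =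
     {Centre} \<union> {Tri i j | i j. True} \<union> Pendent ` {..<n + 1 - 2 * m}
       \<union> Near ` {..<m - 3} \<union> Far ` {..<m - 3}"

definition B_edges :: "nat \<Rightarrow> nat \<Rightarrow> bvertex set set" where
  "B_edges n m =
     {{Centre, Tri i j} | i j. True} \<union> {{Tri i False, Tri i True} | i. True}
       \<union> {{Centre, Pendent k} | k. k < n + 1 - 2 * m}
       \<union> {{Centre, Near k} | k. k < m - 3} \<union> {{Near k, Far k} | k. k < m - 3}"

end

theory Submission
  imports Defs
begin

text \<open>
  Split the edges into a perfect matching \<open>M\<close> and the set \<open>N\<close> of the \<open>m + 1\<close> other edges. The load
  of an edge is the sum of the \<open>N\<close>-degrees of its ends, so its degree sum is its load plus 2. The
  load of an edge of \<open>N\<close> is one more than the number of edges of \<open>N\<close> meeting it, hence at most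
  \<open>m + 2\<close>, with equality throughout if and only if \<open>N\<close> is a star; stars give exactly \<open>B(2m, m)\<close>.
  That every other graph is strictly worse is shown by induction on \<open>m\<close>. If some matching edge has
  load 1, then it is deleted together with the edge of \<open>N\<close> attaching it to a vertex \<open>u\<close>: by convexity
  of \<open>1/sqrt\<close> the index drops by at least a function of the \<open>N\<close>-degree of \<open>u\<close> that is strictly
  decreasing and that equals the increment of the bound when this degree is \<open>m + 1\<close>. If all matching
  edges have load at least 2, their loads are 2 up to a total excess of 2, and comparing \<open>1/sqrt\<close>
  with a secant suffices.
\<close>

section \<open>Convexity and numerical values of \<open>1/sqrt\<close> at positive integers\<close>

definition isq :: "nat \<Rightarrow> real" where
  "isq n = 1 / sqrt (real n)"

text \<open>Discrete convexity: rationalising turns the difference into the reciprocal of a product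
  whose factors all grow with \<open>n\<close>.\<close>

lemma isq_diff_antimono:
  assumes "0 < a" "a \<le> b"
  shows "isq b - isq (Suc b) \<le> isq a - isq (Suc a)"
proof -
  have eq: "isq n - isq (Suc n) =
      1 / (sqrt (real n) * sqrt (real (Suc n)) * (sqrt (real n) + sqrt (real (Suc n))))"
    if "0 < n" for n
  proof -
    define s t where "s = sqrt (real n)" and "t = sqrt (real (Suc n))"
    have pos: "s > 0" "t > 0" and sq: "s\<^sup>2 = real n" "t\<^sup>2 = real n + 1"
      using that by (auto simp: s_def t_def)
    have "(t - s) * (t + s) = 1"
      using sq by (simp add: algebra_simps power2_eq_square)
    then have "1 / s - 1 / t = 1 / (s * t * (s + t))"
      using pos by (simp add: divide_simps) (simp add: algebra_simps)
    then show ?thesis by (simp add: isq_def s_def t_def)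
  qed
  show ?thesis
    unfolding eq[OF assms(1)] eq[OF less_le_trans[OF assms]]
    using assms by (intro divide_left_mono mult_mono add_mono mult_pos_pos add_pos_pos) auto
qed

text \<open>By convexity the line through the values at \<open>a\<close> and \<open>a + 1\<close>
  stays below \<open>isq\<close> at every positive integer; the induction moves away from
  \<open>a\<close> upwards or downwards.\<close>

lemma isq_above_secant:
  assumes "0 < a" "0 < s"
  shows "isq s \<ge> isq a - (real s - real a) * (isq a - isq (Suc a))"
proof (cases "a \<le> s")
  case True
  then show ?thesis
  proof (induction s rule: dec_induct)
    case (step n)
    then show ?case
      using isq_diff_antimono[of a n] assms(1) by (simp add: algebra_simps)
  qed simp
next
  case False
  then have "s \<le> a" by simp
  then show ?thesis using assms(2)
  proof (induction s rule: inc_induct)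
    case (step n)
    then show ?case
      using isq_diff_antimono[of n a] by (simp add: algebra_simps)
  qed simp
qed

lemma isq_antimono: "0 < a \<Longrightarrow> a \<le> b \<Longrightarrow> isq b \<le> isq a"
  by (simp add: isq_def frac_le)

lemma isq_ge: "0 < n \<Longrightarrow> 0 \<le> a \<Longrightarrow> a\<^sup>2 * real n \<le> 1 \<Longrightarrow> a \<le> isq n"
  using real_sqrt_le_mono[of "a\<^sup>2 * real n" 1]
  by (simp add: isq_def real_sqrt_mult pos_le_divide_eq)

lemma isq_le: "0 < n \<Longrightarrow> 0 \<le> a \<Longrightarrow> 1 \<le> a\<^sup>2 * real n \<Longrightarrow> isq n \<le> a"
  using real_sqrt_le_mono[of 1 "a\<^sup>2 * real n"]
  by (simp add: isq_def real_sqrt_mult pos_divide_le_eq)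

lemma isq_square [simp]: "isq 4 = 1/2" "isq 9 = 1/3"
  by (auto simp: isq_def real_sqrt_unique[of 2 4, simplified] real_sqrt_unique[of 3 9, simplified])

lemma isq_numeric:
  "isq 3 \<le> 57736/100000" "57734/100000 \<le> isq 3"
  "isq 5 \<le> 44722/100000" "44721/100000 \<le> isq 5"
  "isq 6 \<le> 40825/100000" "40824/100000 \<le> isq 6"
  "isq 7 \<le> 37797/100000" "37796/100000 \<le> isq 7"
  "isq 8 \<le> 35356/100000" "35355/100000 \<le> isq 8"
  by (rule isq_ge isq_le, simp, simp, simp add: power2_eq_square)+

section \<open>The bound of the theorem and its increments\<close>

definition bd :: "nat \<Rightarrow> real" where
  "bd m = (real m + 1) * isq (m + 4) + isq (m + 3) + (real m - 3) * isq 3 + 1"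

text \<open>Least drop of the weight in the deletion step, \<open>x\<close> being the
  \<open>N\<close>-degree of \<open>u\<close> before it. The deleted edges contribute
  \<open>isq 3\<close> and \<open>isq (x + 3)\<close>, each of the \<open>x - 1\<close> other
  \<open>N\<close>-edges at \<open>u\<close> contributes \<open>isq (x + 3) - isq (x + 2)\<close>,
  and the matching edge at \<open>u\<close> contributes
  \<open>isq (x + 2) - isq (x + 1)\<close>.\<close>

definition bd_step :: "nat \<Rightarrow> real" where
  "bd_step x = isq 3 + real x * isq (x + 3) - (real x - 2) * isq (x + 2) - isq (x + 1)"

lemma bd_Suc: "bd (Suc m) = bd m + bd_step (m + 2)"
  by (simp add: bd_def bd_step_def algebra_simps eval_nat_numeral)

text \<open>Up to the constant \<open>isq 3\<close>, \<open>bd_step\<close> is a forward difference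
  of the function \<open>b\<close>, which is concave from 2 on. Concavity follows from the sign of
  the second derivative.\<close>

lemma bd_step_decreasing:
  assumes "0 < x"
  shows "bd_step (Suc x) < bd_step x"
proof -
  define b where "b z = (z + 1) powr (1/2) - 3 * (z + 1) powr (-1/2) + z powr (-1/2)" for z :: real
  define b' where "b' z = 1/2 * (z + 1) powr (-1/2) + 3/2 * (z + 1) powr (-3/2)
    - 1/2 * z powr (-3/2)" for z :: real
  define b'' where "b'' z = - 1/4 * (z + 1) powr (-3/2) - 9/4 * (z + 1) powr (-5/2)
    + 3/4 * z powr (-5/2)" for z :: real
  have P0: "((\<lambda>z. z powr r) has_real_derivative r * z powr (r - 1)) (at z)" if "z > 0" for z r :: real
    using has_real_derivative_powr[OF that] by simp
  have P1: "((\<lambda>z. (z + 1) powr r) has_real_derivative r * (z + 1) powr (r - 1)) (at z)"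
    if "z > 0" for z r :: real
    using P0[of "z + 1" r] that by (subst DERIV_shift[symmetric]) auto
  have D1: "(b has_real_derivative b' z) (at z)" if "z > 0" for z
    unfolding b_def b'_def
    by (rule DERIV_cong, (rule DERIV_add DERIV_diff DERIV_cmult P0[OF that] P1[OF that])+) simp
  have D2: "(b' has_real_derivative b'' z) (at z)" if "z > 0" for z
    unfolding b'_def b''_def
    by (rule DERIV_cong, (rule DERIV_add DERIV_diff DERIV_cmult P0[OF that] P1[OF that])+) simp
  have neg: "b'' z < 0" if "z \<ge> 2" for z
  proof -
    define q where "q = (z + 1) powr (-5/2)"
    have "q > 0" using that by (simp add: q_def)
    have q3: "(z + 1) powr (-3/2) = (z + 1) * q"
      using that powr_add[of "z + 1" 1 "-5/2"] by (simp add: q_def)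
    \<comment> \<open>For \<open>z >= 2\<close> the bound \<open>z + 1 <= 3/2 * z\<close> expresses
      everything through \<open>q\<close>; rounding the exponent \<open>5/2\<close> up to 3 gives
      the rational constant \<open>27/8\<close>.\<close>
    have "z powr (-5/2) = (3/2) powr (5/2) * (3/2 * z) powr (-5/2)"
      using that by (subst powr_mult) (auto simp flip: powr_add mult.assoc)
    also have "\<dots> \<le> (3/2) powr 3 * q"
      unfolding q_def using that by (intro mult_mono powr_mono powr_mono2') auto
    also have "\<dots> = 27/8 * q" by (simp add: power3_eq_cube)
    finally have "b'' z \<le> - 1/4 * ((z + 1) * q) - 9/4 * q + 3/4 * (27/8 * q)"
      unfolding b''_def q3 q_def[symmetric] by simp
    also have "\<dots> < 0"
      using that mult_right_mono[of 3 "z + 1" q] \<open>q > 0\<close> by (simp add: algebra_simps)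
    finally show ?thesis .
  qed
  have anti: "b' v < b' u" if "2 \<le> u" "u < v" for u v
    using that by (intro DERIV_neg_imp_decreasing[of u v b']) (use D2 neg in force)+
  have step: "bd_step (Suc n) = isq 3 + (b (real n + 3) - b (real n + 2))" for n
  proof -
    have "u / sqrt u = sqrt u" if "u > 0" for u :: real
      using that by (simp add: real_div_sqrt)
    then have "sqrt (real n + 4) = (real n + 4) / sqrt (real n + 4)"
       "sqrt (real n + 3) = (real n + 3) / sqrt (real n + 3)" by simp_all
    then have b_eq: "b (real n + 3) = (real n + 1) / sqrt (real n + 4) + 1 / sqrt (real n + 3)"
      "b (real n + 2) = real n / sqrt (real n + 3) + 1 / sqrt (real n + 2)"
      unfolding b_def using powr_minus_divide[of _ "1/2::real"]
      by (simp_all add: add.assoc powr_half_sqrt add_divide_distrib)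
    show ?thesis
      unfolding b_eq by (simp add: bd_step_def isq_def add_divide_distrib diff_divide_distrib algebra_simps)
  qed
  obtain n where n: "x = Suc n" using assms by (cases x) auto
  \<comment> \<open>Two consecutive differences are derivatives at points of adjacent unit
    intervals, so \<open>u < v\<close>.\<close>
  obtain u where u: "real n + 2 < u" "u < real n + 3" "b (real n + 3) - b (real n + 2) = b' u"
    using MVT2[of "real n + 2" "real n + 3" b b'] D1 by auto
  obtain v where v: "real n + 3 < v" "v < real n + 4" "b (real n + 4) - b (real n + 3) = b' v"
    using MVT2[of "real n + 3" "real n + 4" b b'] D1 by auto
  have "b' v < b' u" using u v by (intro anti) auto
  then show ?thesis using step[of n] step[of "Suc n"] u v n by (simp add: algebra_simps)
qed

lemma bd_step_less:
  assumes "0 < x" "x < y"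
  shows "bd_step y < bd_step x"
proof -
  have "Suc x \<le> y" using assms(2) by simp
  then show ?thesis
  proof (induction y rule: dec_induct)
    case base
    show ?case using assms(1) by (rule bd_step_decreasing)
  next
    case (step n)
    then show ?case using bd_step_decreasing[of n] by simp
  qed
qed

text \<open>Numerical comparison for \<open>weight_without_leaves\<close>. Raising \<open>m\<close>
  by one increases the right-hand side by \<open>1/2 + 2 * isq 7 - isq 8\<close>, about 0.90, but
  \<open>bd\<close> by at most \<open>bd_step 6 < 4/5\<close>.\<close>

lemma bd_less_without_leaves:
  assumes "4 \<le> m"
  shows "bd m < (real m - 1) * isq 4 + isq 6 + (real m + 1) * isq 7 - (7 - real m) * (isq 7 - isq 8)"
  using assms
proof (induction m rule: dec_induct)
  case base
  then show ?case using isq_numeric by (simp add: bd_def algebra_simps)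
next
  case (step n)
  have "bd_step (n + 2) \<le> bd_step 6"
    using bd_step_less[of 6 "n + 2"] step.hyps by (cases "n = 4") auto
  moreover have "bd_step 6 < 4/5"
    using isq_numeric by (simp add: bd_step_def)
  ultimately have "bd_step (n + 2) < 1/2 + 2 * isq 7 - isq 8"
    using isq_numeric(8) isq_numeric(9) by linarith
  then show ?case
    using step.IH unfolding bd_Suc by (simp add: field_simps)
qed

section \<open>Meeting edges, loads and double counting\<close>

lemma pairwise_meeting_edges_star:
  assumes two: "\<And>e. e \<in> N \<Longrightarrow> card e = 2"
    and meet: "\<And>e e'. e \<in> N \<Longrightarrow> e' \<in> N \<Longrightarrow> e \<inter> e' \<noteq> {}"
    and big: "4 \<le> card N"
  shows "\<exists>c. \<forall>e\<in>N. c \<in> e"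
proof (rule ccontr)
  assume no: "\<nexists>c. \<forall>e\<in>N. c \<in> e"
  obtain e1 where e1: "e1 \<in> N" using big by fastforce
  then obtain a b where ab: "e1 = {a, b}" "a \<noteq> b" using two card_2_iff by metis
  obtain e2 where e2: "e2 \<in> N" "a \<notin> e2" using no by blast
  have "b \<in> e2" using meet[OF e1 e2(1)] ab e2 by auto
  obtain c where c: "e2 = {b, c}" "c \<noteq> b" "c \<noteq> a"
    using two[OF e2(1)] \<open>b \<in> e2\<close> e2(2) by (auto simp: card_2_iff)
  obtain e3 where e3: "e3 \<in> N" "b \<notin> e3" using no by blast
  have "a \<in> e3" "c \<in> e3" using meet[OF e1 e3(1)] meet[OF e2(1) e3(1)] ab c e3 by auto
  \<comment> \<open>The edges \<open>e1\<close>, \<open>e2\<close>, \<open>e3\<close> form a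
    triangle. An edge meeting all its sides contains two of its vertices, hence is a side, which
    leaves at most three edges.\<close>
  have "N \<subseteq> {{a, b}, {b, c}, {a, c}}"
  proof
    fix e assume e: "e \<in> N"
    have "e3 = {a, c}"
      using two[OF e3(1)] \<open>a \<in> e3\<close> \<open>c \<in> e3\<close> c by (auto simp: card_2_iff)
    then have "e \<inter> {a, b} \<noteq> {}" "e \<inter> {b, c} \<noteq> {}" "e \<inter> {a, c} \<noteq> {}"
      using meet[OF e] e1 e2 e3 ab c by auto
    then show "e \<in> {{a, b}, {b, c}, {a, c}}"
      using two[OF e] ab c by (auto simp: card_2_iff)
  qed
  then have "card N \<le> card {{a, b}, {b, c}, {a, c}}" by (intro card_mono) auto
  also have "\<dots> \<le> 3" by (simp add: card_insert_if)
  finally show False using big by simp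
qed

definition load :: "'a set set \<Rightarrow> 'a set \<Rightarrow> nat" where
  "load N e = (\<Sum>w\<in>e. degree N w)"

definition weight :: "'a set set \<Rightarrow> 'a set set \<Rightarrow> real" where
  "weight M N = (\<Sum>e\<in>M \<union> N. isq (2 + load N e))"

text \<open>Inclusion-exclusion over the \<open>N\<close>-edges at the two ends: only
  \<open>e\<close> itself can contain both ends and be counted twice.\<close>

lemma load_eq_card_meeting:
  assumes "finite N" "\<And>e'. e' \<in> N \<Longrightarrow> card e' = 2" "card e = 2"
  shows "load N e = card {e' \<in> N. e' \<inter> e \<noteq> {}} + (if e \<in> N then 1 else 0)"
proof -
  obtain u v where uv: "e = {u, v}" "u \<noteq> v" using assms(3) card_2_iff by metis
  define A B where "A = {e' \<in> N. u \<in> e'}" and "B = {e' \<in> N. v \<in> e'}"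
  have fin: "finite A" "finite B" using assms(1) by (auto simp: A_def B_def)
  have "A \<inter> B = (if e \<in> N then {e} else {})"
  proof -
    have "e' = e" if "e' \<in> A \<inter> B" for e'
      using that uv assms(2)[of e'] by (auto simp: A_def B_def card_2_iff)
    then show ?thesis using uv by (auto simp: A_def B_def)
  qed
  moreover have "A \<union> B = {e' \<in> N. e' \<inter> e \<noteq> {}}" using uv by (auto simp: A_def B_def)
  moreover have "load N e = card A + card B"
    using uv by (simp add: load_def degree_def A_def B_def)
  ultimately show ?thesis using card_Un_Int[OF fin] by simp
qed

lemma sum_degree_swap:
  assumes "finite V" "finite N" "\<And>e. e \<in> N \<Longrightarrow> e \<subseteq> V"
  shows "(\<Sum>e\<in>N. \<Sum>w\<in>e. f w) = (\<Sum>w\<in>V. degree N w * f w)"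
proof -
  have "(\<Sum>e\<in>N. \<Sum>w\<in>e. f w) = (\<Sum>e\<in>N. \<Sum>w | w \<in> V \<and> w \<in> e. f w)"
    using assms(3) by (intro sum.cong refl arg_cong2[where f = sum]) blast
  also have "\<dots> = (\<Sum>w\<in>V. \<Sum>e | e \<in> N \<and> w \<in> e. f w)"
    by (rule sum.swap_restrict) (use assms in auto)
  finally show ?thesis by (simp add: degree_def)
qed

text \<open>A connected graph with the perfect matching \<open>M\<close> and remaining edges \<open>N\<close>, having one edge
  more than it has vertices. Connectivity is stated through cuts, a form that is inherited when a
  pendent matching edge is deleted.\<close>

locale matched_bicyclic =
  fixes M N :: "'a set set"
  assumes finite_M: "finite M"
    and disjoint_M: "disjoint M"
    and card_M: "e \<in> M \<Longrightarrow> card e = 2"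
    and card_N: "e \<in> N \<Longrightarrow> card e = 2"
    and N_subset: "e \<in> N \<Longrightarrow> e \<subseteq> \<Union>M"
    and M_Int_N: "M \<inter> N = {}"
    and card_N_eq: "card N = Suc (card M)"
    and cut: "S \<subseteq> \<Union>M \<Longrightarrow> S \<noteq> {} \<Longrightarrow> S \<noteq> \<Union>M \<Longrightarrow>
      \<exists>e\<in>M \<union> N. e \<inter> S \<noteq> {} \<and> \<not> e \<subseteq> S"
begin

lemma finite_N: "finite N"
  using card_N_eq by (metis card.infinite nat.distinct(1))

lemma finite_edge: "e \<in> M \<union> N \<Longrightarrow> finite e"
  using card_M card_N by (metis Un_iff card.infinite zero_neq_numeral)

lemma finite_V: "finite (\<Union>M)"
  using finite_M finite_edge by auto

lemma load_N: "e \<in> N \<Longrightarrow> load N e = Suc (card {e' \<in> N. e' \<inter> e \<noteq> {}})"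
  using load_eq_card_meeting[OF finite_N card_N card_N] by auto

lemma load_M: "e \<in> M \<Longrightarrow> load N e = card {e' \<in> N. e' \<inter> e \<noteq> {}}"
  using load_eq_card_meeting[OF finite_N card_N card_M] M_Int_N by auto

lemma load_N_le: "e \<in> N \<Longrightarrow> load N e \<le> card M + 2"
  using card_mono[OF finite_N, of "{e' \<in> N. e' \<inter> e \<noteq> {}}"] card_N_eq load_N by auto

lemma load_M_le: "e \<in> M \<Longrightarrow> load N e \<le> card M + 1"
  using card_mono[OF finite_N, of "{e' \<in> N. e' \<inter> e \<noteq> {}}"] card_N_eq load_M by auto

text \<open>A second matching edge makes \<open>e\<close> a proper vertex subset, so some edge
  crosses its cut; matching edges are disjoint, so the crossing edge lies in
  \<open>N\<close>.\<close>

lemma load_M_pos: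
  assumes "e \<in> M" "2 \<le> card M"
  shows "0 < load N e"
proof -
  obtain e' where e': "e' \<in> M" "e' \<noteq> e"
    using assms by (metis card_le_Suc0_iff_eq finite_M not_less_eq_eq numeral_2_eq_2)
  have "e' \<inter> e = {}" using disjointD[OF disjoint_M e'(1) assms(1) e'(2)] .
  moreover have "e' \<noteq> {}" "e \<noteq> {}" using card_M e' assms by fastforce+
  ultimately have "e \<noteq> \<Union>M" using e' by blast
  then obtain a where a: "a \<in> M \<union> N" "a \<inter> e \<noteq> {}" "\<not> a \<subseteq> e"
    using cut[of e] assms(1) \<open>e \<noteq> {}\<close> by auto
  then have "a \<notin> M" using disjointD[OF disjoint_M _ assms(1), of a] by auto
  then have "a \<in> {e' \<in> N. e' \<inter> e \<noteq> {}}" using a by auto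
  then show ?thesis using load_M[OF assms(1)] finite_N by (auto simp: card_gt_0_iff)
qed

lemma sum_over_M: "(\<Sum>e\<in>M. \<Sum>w\<in>e. f w) = (\<Sum>w\<in>\<Union>M. f w)"
  using disjoint_M finite_edge by (subst sum.Union_disjoint) (auto simp: disjoint_def)

text \<open>The handshake identity for \<open>N\<close>, with vertices grouped by matching
  edge.\<close>

lemma sum_load_M: "(\<Sum>e\<in>M. load N e) = 2 * card M + 2"
proof -
  have "(\<Sum>e\<in>M. load N e) = (\<Sum>w\<in>\<Union>M. degree N w * 1)"
    by (simp add: load_def sum_over_M)
  also have "\<dots> = (\<Sum>e\<in>N. card e)"
    using sum_degree_swap[OF finite_V finite_N N_subset, where f = "\<lambda>_. 1"] by simp
  finally show ?thesis using card_N card_N_eq by simp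
qed

text \<open>The left side is the sum of squared \<open>N\<close>-degrees; the squares at the two
  ends of a matching edge add up to at most the square of their sum.\<close>

lemma sum_load_N: "(\<Sum>e\<in>N. load N e) \<le> (\<Sum>e\<in>M. (load N e)\<^sup>2)"
proof -
  have "(\<Sum>e\<in>N. load N e) = (\<Sum>e\<in>M. \<Sum>w\<in>e. degree N w * degree N w)"
    unfolding load_def sum_over_M by (rule sum_degree_swap[OF finite_V finite_N N_subset])
  also have "\<dots> \<le> (\<Sum>e\<in>M. (load N e)\<^sup>2)"
  proof (rule sum_mono)
    fix e assume "e \<in> M"
    then obtain u v where "e = {u, v}" "u \<noteq> v" using card_M card_2_iff by metis
    then show "(\<Sum>w\<in>e. degree N w * degree N w) \<le> (load N e)\<^sup>2"
      by (simp add: load_def power2_eq_square algebra_simps)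
  qed
  finally show ?thesis .
qed

lemma weight_split: "weight M N = (\<Sum>e\<in>M. isq (2 + load N e)) + (\<Sum>e\<in>N. isq (2 + load N e))"
  unfolding weight_def by (rule sum.union_disjoint[OF finite_M finite_N M_Int_N])

section \<open>Strict inequality for \<open>m = 3\<close> and in the absence of matching edges of
  load 1\<close>

lemma weight_small:
  assumes "card M = 3" "\<nexists>c. \<forall>e\<in>N. c \<in> e"
  shows "bd 3 < weight M N"
proof -
  \<comment> \<open>The four \<open>N\<close>-edges have no common vertex, so two are disjoint; this
    improves the load bound of \<open>e\<close> from 5 to 4.\<close>
  obtain e e' where e: "e \<in> N" "e' \<in> N" "e' \<inter> e = {}"
  proof -
    have "4 \<le> card N" using card_N_eq assms(1) by simp
    then show ?thesis using pairwise_meeting_edges_star[of N] card_N assms(2) that by metis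
  qed
  have "{e' \<in> N. e' \<inter> e \<noteq> {}} \<subset> N" using e by auto
  from psubset_card_mono[OF finite_N this] have "load N e \<le> 4"
    using load_N[OF e(1)] card_N_eq assms(1) by simp
  then have "isq 6 \<le> isq (2 + load N e)" by (intro isq_antimono) auto
  moreover have "(\<Sum>a\<in>N - {e}. isq 7) \<le> (\<Sum>a\<in>N - {e}. isq (2 + load N a))"
  proof (rule sum_mono)
    fix a assume "a \<in> N - {e}"
    then have "load N a \<le> 5" using load_N_le[of a] assms(1) by simp
    then show "isq 7 \<le> isq (2 + load N a)" by (intro isq_antimono) auto
  qed
  moreover have "(\<Sum>a\<in>N - {e}. isq 7) = 3 * isq 7"
    using e(1) card_N_eq assms(1) by (simp add: card_Diff_singleton)
  ultimately have N: "isq 6 + 3 * isq 7 \<le> (\<Sum>a\<in>N. isq (2 + load N a))"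
    unfolding sum.remove[OF finite_N e(1)] by linarith
  \<comment> \<open>The three matching loads sum to 8, an excess of 2 over load 2; hence the secant
    starts at \<open>4 = 2 + 2\<close>.\<close>
  have "(\<Sum>a\<in>M. isq (2 + load N a))
      \<ge> (\<Sum>a\<in>M. isq 4 - (real (2 + load N a) - real 4) * (isq 4 - isq (Suc 4)))"
    by (intro sum_mono isq_above_secant) auto
  moreover have "(\<Sum>a\<in>M. isq 4 - (real (2 + load N a) - real 4) * (isq 4 - isq (Suc 4)))
      = 3 * isq 4 - (\<Sum>a\<in>M. real (load N a) - 2) * (isq 4 - isq 5)"
    using assms(1) by (subst sum_subtractf) (simp flip: sum_distrib_right)
  moreover have "(\<Sum>a\<in>M. real (load N a) - 2) = 2"
    using sum_load_M assms(1) by (simp add: sum_subtractf flip: of_nat_sum)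
  ultimately have M: "(\<Sum>a\<in>M. isq (2 + load N a)) \<ge> isq 4 + 2 * isq 5"
    by simp
  have "bd 3 = 4 * isq 7 + isq 6 + 1" by (simp add: bd_def)
  then show ?thesis
    using M N isq_numeric(4,7) unfolding weight_split isq_square by linarith
qed

text \<open>The secant at 7 bounds the \<open>N\<close>-part by a linear function of its total load,
  which \<open>sum_load_N\<close> bounds by squared matching loads. What remains is a sum over
  \<open>M\<close> of a function of a single load in \<open>{2, 3, 4}\<close>.\<close>

lemma weight_without_leaves:
  assumes "4 \<le> card M" "\<And>e. e \<in> M \<Longrightarrow> 2 \<le> load N e"
  shows "bd (card M) < weight M N"
proof -
  define m where "m = real (card M)"
  define d where "d = isq 7 - isq 8"
  have two: "(\<Sum>e\<in>M. load N e - 2) = 2"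
    using sum_load_M assms(2) by (simp add: sum_subtractf_nat)
  have le4: "load N e \<le> 4" if "e \<in> M" for e
    using member_le_sum[OF that, of "\<lambda>e. load N e - 2"] finite_M two by auto
  have "(\<Sum>e\<in>N. isq (2 + load N e))
      \<ge> (\<Sum>e\<in>N. isq 7 - (real (2 + load N e) - real 7) * (isq 7 - isq (Suc 7)))"
    by (intro sum_mono isq_above_secant) auto
  also have "(\<Sum>e\<in>N. isq 7 - (real (2 + load N e) - real 7) * (isq 7 - isq (Suc 7)))
      = (m + 1) * isq 7 - ((\<Sum>e\<in>N. real (load N e)) - 5 * (m + 1)) * d"
    using card_N_eq by (simp add: m_def d_def sum_subtractf sum.distrib flip: sum_distrib_right)
      (simp add: algebra_simps)
  finally have "(\<Sum>e\<in>N. isq (2 + load N e)) \<ge>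
     (m + 1) * isq 7 - ((\<Sum>e\<in>N. real (load N e)) - 5 * (m + 1)) * d" .
  moreover have "(\<Sum>e\<in>N. real (load N e)) * d \<le> (\<Sum>e\<in>M. d * (real (load N e))\<^sup>2)"
  proof -
    have "(\<Sum>e\<in>N. real (load N e)) \<le> (\<Sum>e\<in>M. (real (load N e))\<^sup>2)"
      using sum_load_N by (simp flip: of_nat_sum of_nat_power)
    moreover have "0 \<le> d" using isq_numeric by (simp add: d_def)
    ultimately show ?thesis
      by (simp add: mult_right_mono mult.commute[of d] flip: sum_distrib_right)
  qed
  ultimately have W: "weight M N \<ge> (\<Sum>e\<in>M. isq (2 + load N e) - d * (real (load N e))\<^sup>2)
      + (m + 1) * isq 7 + 5 * (m + 1) * d"
    unfolding weight_split by (simp add: sum_subtractf algebra_simps)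
  \<comment> \<open>The line in the load agrees with the summand at loads 2 and 4, so only load 3
    needs a numerical check. Being linear, its sum depends only on the total excess 2.\<close>
  have le: "(\<Sum>e\<in>M. isq (2 + load N e) - d * (real (load N e))\<^sup>2)
     \<ge> (\<Sum>e\<in>M. isq 4 - 4 * d - real (load N e - 2) * ((isq 4 - isq 6 + 12 * d) / 2))"
  proof (rule sum_mono)
    fix e assume "e \<in> M"
    then have "load N e = 2 \<or> load N e = 3 \<or> load N e = 4" using assms(2) le4 by force
    moreover have "(isq 4 + isq 6) / 2 \<le> isq 5 + d" using isq_numeric by (simp add: d_def)
    ultimately show "isq 4 - 4 * d - real (load N e - 2) * ((isq 4 - isq 6 + 12 * d) / 2)
        \<le> isq (2 + load N e) - d * (real (load N e))\<^sup>2"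
      by (auto simp: field_simps)
  qed
  have eq: "(\<Sum>e\<in>M. isq 4 - 4 * d - real (load N e - 2) * ((isq 4 - isq 6 + 12 * d) / 2))
      = m * (isq 4 - 4 * d) - (isq 4 - isq 6 + 12 * d)"
  proof -
    have "(\<Sum>e\<in>M. real (load N e - 2)) = 2" using two by (metis of_nat_numeral of_nat_sum)
    then show ?thesis
      by (simp add: sum_subtractf m_def flip: sum_distrib_right sum_divide_distrib)
        (simp add: diff_divide_distrib add_divide_distrib)
  qed
  have "m * (isq 4 - 4 * d) - (isq 4 - isq 6 + 12 * d) + (m + 1) * isq 7 + 5 * (m + 1) * d
      \<le> weight M N"
    using order_trans[OF add_right_mono[OF add_right_mono[OF le]] W] unfolding eq .
  moreover have "bd (card M) < (m - 1) * isq 4 + isq 6 + (m + 1) * isq 7 - (7 - m) * d"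
    using bd_less_without_leaves[OF assms(1)] unfolding m_def d_def .
  moreover have "m * (isq 4 - 4 * d) - (isq 4 - isq 6 + 12 * d) + (m + 1) * isq 7 + 5 * (m + 1) * d
      = (m - 1) * isq 4 + isq 6 + (m + 1) * isq 7 - (7 - m) * d"
    by (simp add: algebra_simps del: isq_square)
  ultimately show ?thesis by linarith
qed

end

section \<open>Deletion of a pendent matching edge\<close>

lemma card_2_other:
  assumes "card e = 2" "c \<in> e"
  obtains w where "e = {c, w}" "w \<noteq> c"
  using assms by (auto simp: card_2_iff)

lemma (in matched_bicyclic) M_unique: "e \<in> M \<Longrightarrow> e' \<in> M \<Longrightarrow> w \<in> e \<Longrightarrow> w \<in> e' \<Longrightarrow> e = e'"
  using disjoint_M by (auto simp: disjoint_def)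

text \<open>Load 1 means that a single \<open>N\<close>-edge \<open>e0\<close> attaches
  \<open>e1\<close> to the rest. After both are deleted, only the surviving edges at the outer end
  \<open>u\<close> of \<open>e0\<close> change their load, each by one.\<close>

lemma (in matched_bicyclic) delete_leaf:
  assumes "2 \<le> card M" "e1 \<in> M" "load N e1 = 1"
  obtains e0 u where "matched_bicyclic (M - {e1}) (N - {e0})" "0 < degree N u"
    "weight (M - {e1}) (N - {e0}) + bd_step (degree N u) \<le> weight M N"
proof -
  have "card {e \<in> N. e \<inter> e1 \<noteq> {}} = 1" using load_M assms by simp
  then obtain e0 where e0: "{e \<in> N. e \<inter> e1 \<noteq> {}} = {e0}" by (auto simp: card_1_singleton_iff)
  then have e0N: "e0 \<in> N" and e0e1: "e0 \<inter> e1 \<noteq> {}" by auto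
  have avoid: "e \<inter> e1 = {}" if "e \<in> N - {e0}" for e using e0 that by auto
  have "e0 \<noteq> e1" using M_Int_N e0N assms(2) by auto
  obtain v where v: "v \<in> e0" "v \<in> e1" using e0e1 by auto
  obtain u where u: "e0 = {u, v}" "u \<noteq> v"
    using card_2_other[OF card_N[OF e0N] v(1)] by (metis insert_commute)
  have "u \<notin> e1"
    using \<open>e0 \<noteq> e1\<close> u v card_M[OF assms(2)] by (auto simp: card_2_iff)
  define M' N' where "M' = M - {e1}" and "N' = N - {e0}"
  have UM': "\<Union>M' = \<Union>M - e1"
    using M_unique[OF _ assms(2)] assms(2) by (auto simp: M'_def)
  have avoid': "e \<inter> e1 = {}" if "e \<in> M' \<union> N'" for e
    using that avoid[of e] M_unique[OF _ assms(2), of e] by (auto simp: M'_def N'_def)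
  have cardM': "card M = Suc (card M')" and cardN': "card N = Suc (card N')"
    using card.remove[OF finite_M assms(2)] card.remove[OF finite_N e0N] by (simp_all add: M'_def N'_def)
  have "u \<in> \<Union>M'" using N_subset[OF e0N] u \<open>u \<notin> e1\<close> UM' by auto
  then obtain eu where eu: "eu \<in> M'" "u \<in> eu" by auto

  have matched: "matched_bicyclic M' N'"
  proof
    show "finite M'" "disjoint M'" "M' \<inter> N' = {}" "card N' = Suc (card M')"
      using finite_M disjoint_M M_Int_N card_N_eq cardM' cardN'
      by (auto simp: M'_def N'_def disjoint_def)
    show "card e = 2" if "e \<in> M'" for e using that card_M by (auto simp: M'_def)
    show "card e = 2" if "e \<in> N'" for e using that card_N by (auto simp: N'_def)
    show "e \<subseteq> \<Union>M'" if "e \<in> N'" for e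
      using that avoid'[of e] N_subset[of e] UM' by (auto simp: N'_def)
    fix S assume S: "S \<subseteq> \<Union>M'" "S \<noteq> {}" "S \<noteq> \<Union>M'"
    \<comment> \<open>Adding \<open>e1\<close> to the side containing \<open>u\<close> keeps
      \<open>e0\<close> and \<open>e1\<close> from crossing the cut, so the crossing edge survives
      the deletion.\<close>
    define T where "T = (if u \<in> S then S \<union> e1 else S)"
    have "T \<subseteq> \<Union>M" "T \<noteq> {}" "T \<noteq> \<Union>M"
      using S UM' assms(2) by (auto simp: T_def split: if_splits)
    from cut[OF this] obtain e where e: "e \<in> M \<union> N" "e \<inter> T \<noteq> {}" "\<not> e \<subseteq> T" by (elim bexE conjE)
    have Se1: "S \<inter> e1 = {}" using S UM' by auto
    have "e \<noteq> e1" using e Se1 by (auto simp: T_def split: if_splits)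
    moreover have "e \<noteq> e0" using e Se1 u v by (auto simp: T_def split: if_splits)
    ultimately have "e \<in> M' \<union> N'" using e by (auto simp: M'_def N'_def)
    moreover from avoid'[OF this] e have "e \<inter> S \<noteq> {}" "\<not> e \<subseteq> S"
      by (auto simp: T_def split: if_splits)
    ultimately show "\<exists>e\<in>M' \<union> N'. e \<inter> S \<noteq> {} \<and> \<not> e \<subseteq> S" by blast
  qed
  then interpret R: matched_bicyclic M' N' .

  have deg: "degree N w = (if w = u then Suc (degree N' w) else degree N' w)" if "w \<notin> e1" for w
  proof -
    have "{e \<in> N. w \<in> e} = (if w = u then insert e0 {e \<in> N'. w \<in> e} else {e \<in> N'. w \<in> e})"
      using e0N u v that by (auto simp: N'_def)
    then show ?thesis using finite_N by (auto simp: degree_def N'_def)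
  qed
  have load: "load N e = (if u \<in> e then Suc (load N' e) else load N' e)" if "e \<in> M' \<union> N'" for e
  proof -
    have "load N e = (\<Sum>w\<in>e. degree N' w + (if w = u then 1 else 0))"
    proof (unfold load_def, rule sum.cong[OF refl])
      fix w assume "w \<in> e"
      then have "w \<notin> e1" using avoid'[OF that] by blast
      then show "degree N w = degree N' w + (if w = u then 1 else 0)" by (simp add: deg)
    qed
    then show ?thesis using R.finite_edge[OF that] by (simp add: load_def sum.distrib)
  qed
  have "{e \<in> N. v \<in> e} = {e0}" using e0 v by auto
  then have loade0: "load N e0 = degree N u + 1"
    using u by (simp add: load_def degree_def)

  define x where "x = degree N' u"
  have degu: "degree N u = Suc x" using deg[OF \<open>u \<notin> e1\<close>] by (simp add: x_def)
  \<comment> \<open>The nonpositive change of a term when its load grows by one; by convexity it is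
    largest in absolute value at the smallest load.\<close>
  define g where "g e = isq (3 + load N' e) - isq (2 + load N' e)" for e
  have "M \<union> N = insert e1 (insert e0 (M' \<union> N'))"
    using assms(2) e0N by (auto simp: M'_def N'_def)
  moreover have "e0 \<notin> M' \<union> N'" "e1 \<notin> insert e0 (M' \<union> N')"
    using avoid'[of e0] avoid'[of e1] e0e1 v \<open>e0 \<noteq> e1\<close> by auto
  ultimately have "weight M N = isq 3 + isq (3 + degree N u) + (\<Sum>e\<in>M' \<union> N'. isq (2 + load N e))"
    unfolding weight_def using R.finite_M R.finite_N loade0 assms(3)
    by (simp add: eval_nat_numeral)
  also have "(\<Sum>e\<in>M' \<union> N'. isq (2 + load N e))
      = (\<Sum>e\<in>M' \<union> N'. isq (2 + load N' e) + (if u \<in> e then g e else 0))"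
    by (intro sum.cong) (auto simp: load g_def eval_nat_numeral)
  also have "\<dots> = weight M' N' + (\<Sum>e | e \<in> M' \<union> N' \<and> u \<in> e. g e)"
    using R.finite_M R.finite_N
    by (simp add: weight_def sum.distrib flip: sum.inter_filter)
  also have "{e. e \<in> M' \<union> N' \<and> u \<in> e} = insert eu {e \<in> N'. u \<in> e}"
    using eu R.M_unique[OF _ eu(1)] by auto
  also have "(\<Sum>e\<in>insert eu {e \<in> N'. u \<in> e}. g e) = g eu + (\<Sum>e | e \<in> N' \<and> u \<in> e. g e)"
    using eu R.M_Int_N R.finite_N by (subst sum.insert) auto
  finally have w: "weight M N = isq 3 + isq (x + 4) + weight M' N' + g eu
      + (\<Sum>e | e \<in> N' \<and> u \<in> e. g e)"
    using degu by (simp add: algebra_simps eval_nat_numeral)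
  have loadu: "x \<le> load N' e" if "e \<in> M' \<union> N'" "u \<in> e" for e
    using that R.finite_edge unfolding load_def x_def by (intro member_le_sum) auto
  have "isq (x + 3) - isq (x + 2) \<le> g eu"
    using isq_diff_antimono[of "x + 2" "2 + load N' eu"] loadu[of eu] eu
    by (simp add: g_def eval_nat_numeral)
  \<comment> \<open>The other end of such an edge has positive \<open>N'\<close>-degree, so its load
    is at least \<open>x + 1\<close>, one more than the bound \<open>x\<close> used for
    \<open>eu\<close>.\<close>
  moreover have "(\<Sum>e | e \<in> N' \<and> u \<in> e. g e) \<ge> (\<Sum>e | e \<in> N' \<and> u \<in> e. isq (x + 4) - isq (x + 3))"
  proof (rule sum_mono)
    fix e assume e: "e \<in> {e. e \<in> N' \<and> u \<in> e}"
    then obtain z where z: "e = {u, z}" "u \<noteq> z" using R.card_N[of e] by (auto simp: card_2_iff)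
    have "{e \<in> N'. z \<in> e} \<noteq> {}" using e z by auto
    then have "0 < degree N' z" using R.finite_N by (simp add: degree_def card_gt_0_iff)
    then have "x + 1 \<le> load N' e" using z by (simp add: load_def x_def)
    then show "isq (x + 4) - isq (x + 3) \<le> g e"
      using isq_diff_antimono[of "x + 3" "2 + load N' e"] by (simp add: g_def eval_nat_numeral)
  qed
  moreover have "(\<Sum>e | e \<in> N' \<and> u \<in> e. isq (x + 4) - isq (x + 3)) = real x * (isq (x + 4) - isq (x + 3))"
    by (simp add: x_def degree_def)
  ultimately have "weight M' N' + bd_step (degree N u) \<le> weight M N"
    unfolding w degu by (simp add: bd_step_def algebra_simps eval_nat_numeral)
  moreover have "0 < degree N u" using degu by simp
  ultimately show ?thesis using that matched unfolding M'_def N'_def by blast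
qed

section \<open>Stars attain the bound\<close>

context matched_bicyclic
begin

lemma star_neighbours:
  assumes c: "\<forall>e\<in>N. c \<in> e"
  obtains L where "N = (\<lambda>w. {c, w}) ` L" "c \<notin> L"
proof -
  define L where "L = {w. w \<noteq> c \<and> {c, w} \<in> N}"
  have "N = (\<lambda>w. {c, w}) ` L"
  proof
    show "N \<subseteq> (\<lambda>w. {c, w}) ` L"
    proof
      fix e assume e: "e \<in> N"
      obtain w where "e = {c, w}" "w \<noteq> c" using card_2_other[OF card_N[OF e]] c e by blast
      then show "e \<in> (\<lambda>w. {c, w}) ` L" using e by (auto simp: L_def)
    qed
  qed (auto simp: L_def)
  moreover have "c \<notin> L" by (simp add: L_def)
  ultimately show ?thesis using that by blast
qed

text \<open>The centre has \<open>N\<close>-degree \<open>m + 1\<close> and every other vertex at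
  most 1. The matching edge at the centre thus has load \<open>m + 1\<close>, and the other
  \<open>m - 1\<close> matching edges share the remaining \<open>m + 1\<close>, each getting 1 or
  2.\<close>

lemma star_loads:
  assumes c: "\<forall>e\<in>N. c \<in> e" and "2 \<le> card M"
  obtains ec where "ec \<in> M" "c \<in> ec" "load N ec = card M + 1"
    "\<And>e. e \<in> M - {ec} \<Longrightarrow> load N e = 1 \<or> load N e = 2"
    "(\<Sum>e\<in>M - {ec}. load N e - 1) = 2"
proof -
  have degc: "degree N c = card M + 1"
  proof -
    have "{e \<in> N. c \<in> e} = N" using c by auto
    then show ?thesis using card_N_eq by (simp add: degree_def)
  qed
  have "N \<noteq> {}" using card_N_eq by auto
  then have "c \<in> \<Union>M" using c N_subset by blast
  then obtain ec where ec: "ec \<in> M" "c \<in> ec" by auto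
  have "degree N c \<le> load N ec"
    unfolding load_def using ec finite_edge by (intro member_le_sum) auto
  then have lec: "load N ec = card M + 1" using load_M_le[OF ec(1)] degc by simp
  have deg1: "degree N w \<le> 1" if "w \<noteq> c" for w
  proof -
    have "e = {c, w}" if "e \<in> N" "w \<in> e" for e
      using that \<open>w \<noteq> c\<close> c card_N[of e] by (auto simp: card_2_iff)
    then have "{e \<in> N. w \<in> e} \<subseteq> {{c, w}}" by auto
    then show ?thesis using card_mono[of "{{c, w}}"] by (fastforce simp: degree_def)
  qed
  have le2: "load N e = 1 \<or> load N e = 2" if e: "e \<in> M - {ec}" for e
  proof -
    have "c \<notin> e" using e ec M_unique by blast
    then have "load N e \<le> (\<Sum>w\<in>e. 1)" unfolding load_def by (intro sum_mono deg1) auto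
    then show ?thesis using load_M_pos[of e] e assms(2) card_M[of e] by force
  qed
  have "(\<Sum>e\<in>M - {ec}. load N e) = card M + 1"
    using sum_load_M lec sum.remove[OF finite_M ec(1), of "load N"] by simp
  moreover have "(\<Sum>e\<in>M - {ec}. load N e - 1) = (\<Sum>e\<in>M - {ec}. load N e) - (\<Sum>e\<in>M - {ec}. 1)"
    using le2 by (intro sum_subtractf_nat) force
  ultimately have "(\<Sum>e\<in>M - {ec}. load N e - 1) = 2"
    using ec(1) finite_M assms(2) by (simp add: card_Diff_singleton)
  then show ?thesis using that ec lec le2 by blast
qed

text \<open>On the two values 1 and 2 the term is affine in the load, so the sum over the other
  matching edges depends only on their total load. All \<open>N\<close>-edges meet, so each has load
  \<open>m + 2\<close>.\<close>

lemma weight_star: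
  assumes c: "\<forall>e\<in>N. c \<in> e" and "3 \<le> card M"
  shows "weight M N = bd (card M)"
proof -
  obtain ec where ec: "ec \<in> M" "load N ec = card M + 1"
    and le2: "\<And>e. e \<in> M - {ec} \<Longrightarrow> load N e = 1 \<or> load N e = 2"
    and two: "(\<Sum>e\<in>M - {ec}. load N e - 1) = 2"
    using star_loads[OF c] assms(2) by auto
  have "(\<Sum>e\<in>M - {ec}. isq (2 + load N e))
      = (\<Sum>e\<in>M - {ec}. isq 3 - real (load N e - 1) * (isq 3 - isq 4))"
  proof (rule sum.cong[OF refl])
    fix e assume "e \<in> M - {ec}"
    from le2[OF this] show "isq (2 + load N e) = isq 3 - real (load N e - 1) * (isq 3 - isq 4)"
      by (elim disjE, simp add: numeral_3_eq_3, simp)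
  qed
  also have "\<dots> = (real (card M) - 1) * isq 3 - real (\<Sum>e\<in>M - {ec}. load N e - 1) * (isq 3 - isq 4)"
    using ec(1) finite_M assms(2)
    by (simp add: sum_subtractf card_Diff_singleton sum_distrib_right)
  finally have "(\<Sum>e\<in>M - {ec}. isq (2 + load N e)) = (real (card M) - 3) * isq 3 + 1"
    unfolding two by (simp add: algebra_simps)
  moreover have "2 + load N ec = card M + 3" using ec(2) by simp
  ultimately have M: "(\<Sum>e\<in>M. isq (2 + load N e)) =
      isq (card M + 3) + (real (card M) - 3) * isq 3 + 1"
    using sum.remove[OF finite_M ec(1), of "\<lambda>e. isq (2 + load N e)"] by (simp only: add.assoc)
  have "{e' \<in> N. e' \<inter> e \<noteq> {}} = N" if "e \<in> N" for e using that c by auto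
  then have "(\<Sum>e\<in>N. isq (2 + load N e)) = (\<Sum>e\<in>N. isq (card M + 4))"
    using load_N card_N_eq by (intro sum.cong) (auto simp: algebra_simps eval_nat_numeral)
  then show ?thesis
    unfolding weight_split M using card_N_eq by (simp add: bd_def algebra_simps)
qed

end

section \<open>The induction for graphs that are not stars\<close>

lemma weight_not_star:
  assumes "matched_bicyclic M N" "3 \<le> card M" "\<nexists>c. \<forall>e\<in>N. c \<in> e"
  shows "bd (card M) < weight M N"
  using assms
proof (induction "card M" arbitrary: M N rule: less_induct)
  case less
  interpret matched_bicyclic M N by fact
  show ?case
  proof (cases "card M = 3")
    case True
    then show ?thesis using weight_small less.prems(3) by simp
  next
    case False
    then have big: "4 \<le> card M" using less.prems(2) by simp
    show ?thesis
    proof (cases "\<forall>e\<in>M. 2 \<le> load N e")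
      case True
      then show ?thesis using weight_without_leaves big by blast
    next
      case False
      then obtain e1 where e1: "e1 \<in> M" "load N e1 = 1"
        using load_M_pos big by fastforce
      obtain e0 u where R: "matched_bicyclic (M - {e1}) (N - {e0})" and u: "0 < degree N u"
        and w: "weight (M - {e1}) (N - {e0}) + bd_step (degree N u) \<le> weight M N"
        using delete_leaf[OF _ e1] big by auto
      define k where "k = card (M - {e1})"
      have card: "card M = Suc k" unfolding k_def by (rule card.remove[OF finite_M e1(1)])
      \<comment> \<open>Since \<open>N\<close> is not a star, some \<open>N\<close>-edge misses
        \<open>u\<close>; this makes the increment comparison strict.\<close>
      have "{e \<in> N. u \<in> e} \<subset> N" using less.prems(3) by auto
      from psubset_card_mono[OF finite_N this] have "degree N u < card M + 1"
        by (simp add: degree_def card_N_eq)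
      then have "bd_step (card M + 1) < bd_step (degree N u)" using u by (intro bd_step_less)
      moreover have "bd k \<le> weight (M - {e1}) (N - {e0})"
      \<comment> \<open>The deletion may leave a star; a non-strict bound for the smaller graph is
        then enough.\<close>
      proof (cases "\<exists>c. \<forall>e\<in>N - {e0}. c \<in> e")
        case True
        then obtain c where c: "\<forall>e\<in>N - {e0}. c \<in> e" ..
        have "3 \<le> card (M - {e1})" using card big unfolding k_def by linarith
        from matched_bicyclic.weight_star[OF R c this] show ?thesis unfolding k_def by simp
      next
        case False
        have "card (M - {e1}) < card M" "3 \<le> card (M - {e1})"
          using card big unfolding k_def by linarith+
        from less.hyps[OF this(1) R this(2) False] show ?thesis unfolding k_def by simp
      qed
      moreover have "bd (card M) = bd k + bd_step (card M + 1)"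
        unfolding card bd_Suc by simp
      ultimately show ?thesis using w by linarith
    qed
  qed
qed

section \<open>Stars are exactly the graphs isomorphic to \<open>B(2m, m)\<close>\<close>

lemma graph_iso_image:
  assumes "bij_betw g V' V" "\<And>e. e \<in> E' \<Longrightarrow> e \<subseteq> V'"
  shows "graph_iso V ((`) g ` E') V' E'"
  unfolding graph_iso_def
proof (intro exI conjI ballI)
  \<comment> \<open>The map \<open>g\<close> runs from the model graph to the given one, so the
    isomorphism is its inverse.\<close>
  let ?f = "inv_into V' g"
  show "bij_betw ?f V V'" by (rule bij_betw_inv_into[OF assms(1)])
  have inj: "inj_on g V'" and V: "g ` V' = V" using assms(1) by (auto simp: bij_betw_def)
  fix u v assume uv: "u \<in> V" "v \<in> V"
  have "g ` {?f u, ?f v} = {u, v}" using uv V by (simp add: f_inv_into_f)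
  moreover have "{?f u, ?f v} = e" if "{u, v} = g ` e" "e \<in> E'" for e
    using inv_into_image_cancel[OF inj assms(2)[OF that(2)]] that(1)[symmetric] by simp
  ultimately show "({u, v} \<in> (`) g ` E') = ({?f u, ?f v} \<in> E')"
    by (metis image_iff)
qed

lemma B_verts_balanced:
  "B_verts (2 * m) m = {Centre, Pendent 0} \<union> range (case_prod Tri) \<union> Near ` {..<m - 3} \<union> Far ` {..<m - 3}"
  by (auto simp: B_verts_def)

text \<open>The first set is the star in the role of \<open>N\<close>, the second a perfect matching
  in the role of \<open>M\<close>: the one pendent edge, the triangle sides opposite the centre and
  the outer path edges.\<close>

lemma B_edges_balanced:
  "B_edges (2 * m) m =
     (\<lambda>x. {Centre, x}) ` (range (case_prod Tri) \<union> Near ` {..<m - 3})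
     \<union> insert {Centre, Pendent 0}
         (range (\<lambda>i. {Tri i False, Tri i True}) \<union> (\<lambda>k. {Near k, Far k}) ` {..<m - 3})"
  by (auto simp: B_edges_def)

lemma UNIV_bool_pair: "(UNIV :: (bool \<times> bool) set) = {(False, False), (False, True), (True, False), (True, True)}"
  by (auto simp: UNIV_bool)

text \<open>An upper bound makes any map of these vertices onto a set of \<open>2 * m\<close>
  elements injective.\<close>

lemma card_B_verts_le: "3 \<le> m \<Longrightarrow> card (B_verts (2 * m) m) \<le> 2 * m"
proof -
  assume "3 \<le> m"
  have "card (B_verts (2 * m) m) \<le> card {Centre, Pendent 0} + card (range (case_prod Tri))
      + card (Near ` {..<m - 3}) + card (Far ` {..<m - 3})"
    unfolding B_verts_balanced by (meson add_le_mono1 card_Un_le order_trans)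
  also have "\<dots> \<le> 2 + 4 + (m - 3) + (m - 3)"
    using card_image_le[of "{..<m - 3}" Near] card_image_le[of "{..<m - 3}" Far]
    by (intro add_mono) (auto simp: UNIV_bool_pair)
  finally show ?thesis using \<open>3 \<le> m\<close> by simp
qed

context matched_bicyclic
begin

lemma card_V: "card (\<Union>M) = 2 * card M"
  using sum_over_M[of "\<lambda>_. 1::nat"] card_M by simp

lemma star_isomorphic_B:
  assumes c: "\<forall>e\<in>N. c \<in> e" and "3 \<le> card M"
  shows "graph_iso (\<Union>M) (M \<union> N) (B_verts (2 * card M) (card M)) (B_edges (2 * card M) (card M))"
proof -
  define m where "m = card M"
  obtain L where L: "N = (\<lambda>w. {c, w}) ` L" "c \<notin> L"
    using star_neighbours[OF c] by blast
  obtain ec where ec: "ec \<in> M" "c \<in> ec"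
    and le2: "\<And>e. e \<in> M - {ec} \<Longrightarrow> load N e = 1 \<or> load N e = 2"
    and two: "(\<Sum>e\<in>M - {ec}. load N e - 1) = 2"
    using star_loads[OF c] assms(2) by auto
  obtain c' where c': "ec = {c, c'}" "c' \<noteq> c" using card_M[OF ec(1)] ec(2) by (auto simp: card_2_iff)
  have "c' \<notin> L" using ec(1) c' L(1) M_Int_N by auto
  have deg: "degree N w = (if w \<in> L then 1 else 0)" if "w \<noteq> c" for w
  proof -
    have "{e \<in> N. w \<in> e} = (if w \<in> L then {{c, w}} else {})" using that L by auto
    then show ?thesis by (simp add: degree_def)
  qed
  have load: "load N e = card (e \<inter> L)" if "e \<in> M - {ec}" for e
  proof -
    have "c \<notin> e" using that ec M_unique by blast
    then have "load N e = (\<Sum>w\<in>e. if w \<in> L then 1 else 0)"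
      unfolding load_def by (intro sum.cong refl deg) auto
    then show ?thesis using finite_edge that by (simp add: sum.inter_restrict[symmetric])
  qed
  \<comment> \<open>Edges in \<open>P1\<close> have one end adjacent to \<open>c\<close> through
    \<open>N\<close> and become the attached paths; edges in \<open>P2\<close> have two such ends
    and close triangles; \<open>ec\<close> becomes the pendent edge.\<close>
  define P1 P2 where "P1 = {e \<in> M - {ec}. load N e = 1}" and "P2 = {e \<in> M - {ec}. load N e = 2}"
  have M: "M = insert ec (P1 \<union> P2)" using le2 ec(1) by (auto simp: P1_def P2_def)
  have fin: "finite P1" "finite P2" using finite_M by (auto simp: P1_def P2_def)
  \<comment> \<open>On loads 1 and 2, \<open>load N e - 1\<close> is the indicator of load
    2.\<close>
  have "card P2 = (\<Sum>e\<in>M - {ec}. if load N e = 2 then 1 else 0)"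
    using finite_M by (simp add: P2_def flip: sum.inter_filter)
  also have "\<dots> = (\<Sum>e\<in>M - {ec}. load N e - 1)" using le2 by (intro sum.cong) force+
  finally have card2: "card P2 = 2" using two by simp
  moreover have "card M = Suc (card P1 + card P2)"
  proof -
    have "P1 \<inter> P2 = {}" "ec \<notin> P1 \<union> P2" by (auto simp: P1_def P2_def)
    then show ?thesis by (subst M) (use fin in \<open>simp add: card_Un_disjoint\<close>)
  qed
  ultimately have card1: "card P1 = m - 3" by (simp add: m_def)
  obtain h where h: "bij_betw h {..<m - 3} P1"
    using ex_bij_betw_nat_finite[OF fin(1)] card1 by (auto simp: atLeast0LessThan)
  have "\<exists>x y. h k = {x, y} \<and> x \<in> L \<and> y \<notin> L" if "k < m - 3" for k
  proof -
    have hk: "h k \<in> M - {ec}" "load N (h k) = 1"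
      using bij_betwE[OF h] that by (auto simp: P1_def)
    then have "card (h k \<inter> L) = 1" using load[OF hk(1)] by simp
    then obtain x where x: "h k \<inter> L = {x}" by (auto simp: card_1_singleton_iff)
    then obtain y where "h k = {x, y}" "y \<noteq> x"
      using card_2_other[of "h k" x] card_M hk(1) by blast
    then show ?thesis using x by auto
  qed
  then obtain near far where nf: "\<And>k. k < m - 3 \<Longrightarrow> h k = {near k, far k} \<and> near k \<in> L \<and> far k \<notin> L"
    by metis
  have P1: "P1 = (\<lambda>k. {near k, far k}) ` {..<m - 3}"
    using h nf by (auto simp: bij_betw_def image_iff)
  obtain p q where pq: "P2 = {p, q}" using card2 card_2_iff by metis
  have both: "\<exists>x y. e = {x, y} \<and> x \<in> L \<and> y \<in> L" if "e \<in> P2" for e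
  proof -
    have "e \<in> M - {ec}" "load N e = 2" using that by (auto simp: P2_def)
    then have e: "card e = 2" "card (e \<inter> L) = 2" using card_M load[of e] by auto
    then have "e \<inter> L = e" using finite_edge that by (intro card_subset_eq) (auto simp: P2_def)
    then show ?thesis using e(1) by (auto simp: card_2_iff)
  qed
  obtain a1 a2 b1 b2 where ab: "p = {a1, a2}" "q = {b1, b2}" "{a1, a2, b1, b2} \<subseteq> L"
    using both[of p] both[of q] pq by auto
  \<comment> \<open>The first flag selects the triangle, from \<open>p\<close> or \<open>q\<close>,
    the second its vertex.\<close>
  define t where "t i j = (if i then if j then b2 else b1 else if j then a2 else a1)" for i j
  define g where "g x = (case x of Centre \<Rightarrow> c | Tri i j \<Rightarrow> t i j | Pendent k \<Rightarrow> c'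
    | Near k \<Rightarrow> near k | Far k \<Rightarrow> far k)" for x
  have g [simp]: "g Centre = c" "g (Tri i j) = t i j" "g (Pendent k) = c'" "g (Near k) = near k"
    "g (Far k) = far k" for i j k by (simp_all add: g_def)
  have L_eq: "L = {a1, a2, b1, b2} \<union> near ` {..<m - 3}"
  proof
    show "L \<subseteq> {a1, a2, b1, b2} \<union> near ` {..<m - 3}"
    proof
      fix w assume w: "w \<in> L"
      then have "w \<in> \<Union>M" using N_subset L(1) by blast
      moreover have "w \<notin> ec" using w c' \<open>c' \<notin> L\<close> L(2) by auto
      ultimately have "w \<in> p \<or> w \<in> q \<or> (\<exists>k<m - 3. w \<in> {near k, far k})"
        using M P1 pq by auto
      then show "w \<in> {a1, a2, b1, b2} \<union> near ` {..<m - 3}" using ab nf w by auto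
    qed
  qed (use ab nf in auto)
  have V_eq: "g ` B_verts (2 * m) m = \<Union>M"
  proof -
    have "g ` B_verts (2 * m) m = {c, c'} \<union> {a1, a2, b1, b2} \<union> near ` {..<m - 3} \<union> far ` {..<m - 3}"
      unfolding B_verts_balanced UNIV_bool_pair by (simp add: image_Un image_image t_def)
    also have "\<dots> = \<Union>M" unfolding M P1 pq ab c' by auto
    finally show ?thesis .
  qed
  have "inj_on g (B_verts (2 * m) m)"
  proof (rule eq_card_imp_inj_on)
    show fin: "finite (B_verts (2 * m) m)" by (simp add: B_verts_balanced)
    show "card (g ` B_verts (2 * m) m) = card (B_verts (2 * m) m)"
      using card_B_verts_le[of m] card_image_le[OF fin, of g] card_V V_eq assms(2)
      by (simp add: m_def)
  qed
  then have "bij_betw g (B_verts (2 * m) m) (\<Union>M)" using V_eq by (simp add: bij_betw_def)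
  moreover have "e \<subseteq> B_verts (2 * m) m" if "e \<in> B_edges (2 * m) m" for e
    using that by (auto simp: B_verts_balanced B_edges_balanced)
  moreover have "(`) g ` B_edges (2 * m) m = M \<union> N"
  proof -
    have "(`) g ` (\<lambda>x. {Centre, x}) ` (range (case_prod Tri) \<union> Near ` {..<m - 3}) = N"
      unfolding L(1) L_eq UNIV_bool_pair by (auto simp: t_def image_Un image_image)
    moreover have "(`) g ` insert {Centre, Pendent 0}
        (range (\<lambda>i. {Tri i False, Tri i True}) \<union> (\<lambda>k. {Near k, Far k}) ` {..<m - 3}) = M"
      unfolding M P1 pq ab c' UNIV_bool by (auto simp: t_def image_Un image_image)
    ultimately show ?thesis unfolding B_edges_balanced by (simp only: image_Un Un_commute)
  qed
  ultimately show ?thesis using graph_iso_image unfolding m_def by metis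
qed

lemma degree_union:
  assumes "w \<in> \<Union>M"
  shows "degree (M \<union> N) w = Suc (degree N w)"
proof -
  obtain e where e: "e \<in> M" "w \<in> e" using assms by auto
  then have "{e' \<in> M \<union> N. w \<in> e'} = insert e {e' \<in> N. w \<in> e'}"
    using M_unique by blast
  moreover have "e \<notin> N" using e M_Int_N by auto
  ultimately show ?thesis using finite_N by (simp add: degree_def)
qed

lemma sum_connectivity_eq_weight: "sum_connectivity (M \<union> N) = weight M N"
  unfolding sum_connectivity_def weight_def isq_def
proof (rule sum.cong[OF refl])
  fix e assume e: "e \<in> M \<union> N"
  then have "e \<subseteq> \<Union>M" using N_subset by auto
  then have "(\<Sum>w\<in>e. degree (M \<union> N) w) = (\<Sum>w\<in>e. Suc (degree N w))"
    by (intro sum.cong refl degree_union) auto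
  also have "\<dots> = 2 + load N e" using e card_M card_N by (auto simp: load_def sum_Suc)
  finally show "1 / sqrt (real (\<Sum>w\<in>e. degree (M \<union> N) w)) = 1 / sqrt (real (2 + load N e))" by simp
qed

text \<open>The isomorphism may send \<open>M\<close> to another perfect matching, so only degrees
  are compared: the preimage of \<open>Centre\<close> has degree at least \<open>m + 2\<close>, one
  edge of which is in \<open>M\<close>, and the others exhaust \<open>N\<close>.\<close>

lemma star_if_isomorphic_B:
  assumes "graph_iso (\<Union>M) (M \<union> N) (B_verts (2 * card M) (card M)) (B_edges (2 * card M) (card M))"
    and "3 \<le> card M"
  shows "\<exists>c. \<forall>e\<in>N. c \<in> e"
proof -
  define m where "m = card M"
  obtain f where f: "bij_betw f (\<Union>M) (B_verts (2 * m) m)"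
    and edge: "\<And>u v. u \<in> \<Union>M \<Longrightarrow> v \<in> \<Union>M \<Longrightarrow> {u, v} \<in> M \<union> N \<longleftrightarrow> {f u, f v} \<in> B_edges (2 * m) m"
    using assms(1) unfolding graph_iso_def m_def by blast
  define T where "T = insert (Pendent 0) (range (case_prod Tri) \<union> Near ` {..<m - 3})"
  have "card T = m + 2"
  proof -
    have "card (range (case_prod Tri)) = 4" by (simp add: UNIV_bool_pair)
    moreover have "card (Near ` {..<m - 3}) = m - 3" by (simp add: card_image inj_on_def)
    moreover have "range (case_prod Tri) \<inter> Near ` {..<m - 3} = {}"
      "Pendent 0 \<notin> range (case_prod Tri) \<union> Near ` {..<m - 3}" by auto
    ultimately show ?thesis using assms(2) by (simp add: T_def m_def card_Un_disjoint)
  qed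
  define g where "g = inv_into (\<Union>M) f"
  have g: "g x \<in> \<Union>M" "f (g x) = x" if "x \<in> B_verts (2 * m) m" for x
    using that bij_betwE[OF bij_betw_inv_into[OF f]] bij_betw_inv_into_right[OF f]
    unfolding g_def by blast+
  have T: "x \<in> B_verts (2 * m) m" "{Centre, x} \<in> B_edges (2 * m) m" "x \<noteq> Centre" if "x \<in> T" for x
    using that by (auto simp: T_def B_verts_balanced B_edges_balanced)
  have C: "Centre \<in> B_verts (2 * m) m" by (simp add: B_verts_balanced)
  have "{g Centre, g x} \<in> M \<union> N" if "x \<in> T" for x
    unfolding edge[OF g(1)[OF C] g(1)[OF T(1)[OF that]]] g(2)[OF C] g(2)[OF T(1)[OF that]]
    using T(2)[OF that] .
  then have "(\<lambda>x. {g Centre, g x}) ` T \<subseteq> {e \<in> M \<union> N. g Centre \<in> e}" by auto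
  moreover have "inj_on (\<lambda>x. {g Centre, g x}) T"
    by (rule inj_onI) (metis C T(1) doubleton_eq_iff g(2))
  ultimately have "m + 2 \<le> degree (M \<union> N) (g Centre)"
    unfolding degree_def \<open>card T = m + 2\<close>[symmetric]
    using finite_M finite_N by (intro card_inj_on_le) auto
  then have "card N \<le> degree N (g Centre)"
    using degree_union[OF g(1)[OF C]] card_N_eq by (simp add: m_def)
  then have "{e \<in> N. g Centre \<in> e} = N"
    unfolding degree_def using finite_N by (intro card_seteq) auto
  then show ?thesis by blast
qed

end

section \<open>From bicyclic graphs to matched ones, and the theorem\<close>

lemma bicyclic_perfect_matching:
  assumes "bicyclic V E" "card V = 2 * m" "matching_number E = m"
  obtains M where "matched_bicyclic M (E - M)" "M \<subseteq> E" "\<Union>M = V" "card M = m"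
proof -
  have finV: "finite V" and E: "\<And>e. e \<in> E \<Longrightarrow> e \<subseteq> V \<and> card e = 2"
    and conn: "\<And>u v. u \<in> V \<Longrightarrow> v \<in> V \<Longrightarrow> (u, v) \<in> {(x, y). {x, y} \<in> E}\<^sup>*"
    and cardE: "card E = card V + 1"
    using assms(1) by (auto simp: bicyclic_def simple_graph_def connected_graph_def)
  have finE: "finite E" using finite_subset[of E "Pow V"] finV E by auto
  have "{card M |M. is_matching E M} \<subseteq> card ` Pow E" by (auto simp: is_matching_def)
  then have "finite {card M |M. is_matching E M}" using finE by (meson finite_Pow_iff finite_imageI finite_subset)
  moreover have "is_matching E {}" by (simp add: is_matching_def)
  ultimately have "m \<in> {card M |M. is_matching E M}"
    using Max_in assms(3) unfolding matching_number_def by blast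
  then obtain M where M: "M \<subseteq> E" "disjoint M" "card M = m" by (auto simp: is_matching_def)
  have finM: "finite M" using M finE finite_subset by blast
  have "finite e" if "e \<in> M" for e using that M(1) E finV finite_subset by blast
  then have "card (\<Union>M) = (\<Sum>e\<in>M. card e)"
    using M(2) by (intro card_Union_disjoint) (auto simp: disjoint_def pairwise_def disjnt_def)
  also have "\<dots> = (\<Sum>e\<in>M. 2)" using M(1) E by (intro sum.cong) auto
  \<comment> \<open>The \<open>m\<close> disjoint edges cover \<open>2 * m\<close> vertices, hence
    all of \<open>V\<close>.\<close>
  finally have "card (\<Union>M) = card V" using M(3) assms(2) by simp
  moreover have "\<Union>M \<subseteq> V" using M(1) E by blast
  ultimately have UM: "\<Union>M = V" using finV by (intro card_subset_eq)
  have "matched_bicyclic M (E - M)"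
  proof
    show "finite M" "disjoint M" "M \<inter> (E - M) = {}" using finM M by auto
    show "card e = 2" if "e \<in> M" for e using that M E by auto
    show "card e = 2" "e \<subseteq> \<Union>M" if "e \<in> E - M" for e using that E UM by auto
    show "card (E - M) = Suc (card M)"
      using card_Diff_subset[OF finM M(1)] cardE assms(2) M(3) by simp
    fix S assume S: "S \<subseteq> \<Union>M" "S \<noteq> {}" "S \<noteq> \<Union>M"
    obtain u v where uv: "u \<in> S" "v \<in> V" "v \<notin> S" "u \<in> V" using S unfolding UM by blast
    \<comment> \<open>Along a walk from \<open>u\<close> to \<open>v\<close>, either the current
      vertex is still in \<open>S\<close> or a crossing edge has been passed.\<close>
    have "v \<in> S \<or> (\<exists>e\<in>E. e \<inter> S \<noteq> {} \<and> \<not> e \<subseteq> S)"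
      using conn[OF uv(4,2)]
    proof (induction rule: rtrancl_induct)
      case base
      then show ?case using uv by simp
    next
      case (step y z)
      then have "{y, z} \<in> E" by simp
      from step.IH show ?case
      proof
        assume "y \<in> S"
        then show ?case
          using \<open>{y, z} \<in> E\<close> by (cases "z \<in> S") (auto intro!: bexI[of _ "{y, z}"])
      qed (rule disjI2)
    qed
    then show "\<exists>e\<in>M \<union> (E - M). e \<inter> S \<noteq> {} \<and> \<not> e \<subseteq> S" using uv by blast
  qed
  then show ?thesis using that M UM by blast
qed

theorem theorem1:
  fixes V :: "'a set" and E :: "'a set set" and m :: nat
  assumes "m \<ge> 3"
    and "bicyclic V E"
    and "card V = 2 * m"
    and "matching_number E = m"
  shows "sum_connectivity E \<ge>
           (real m + 1) / sqrt (real m + 4) + 1 / sqrt (real m + 3) + (real m - 3) / sqrt 3 + 1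
       \<and> (sum_connectivity E =
           (real m + 1) / sqrt (real m + 4) + 1 / sqrt (real m + 3) + (real m - 3) / sqrt 3 + 1
         \<longleftrightarrow> graph_iso V E (B_verts (2 * m) m) (B_edges (2 * m) m))"
proof -
  obtain M where M: "matched_bicyclic M (E - M)" "M \<subseteq> E" "\<Union>M = V" "card M = m"
    using bicyclic_perfect_matching[OF assms(2-4)] .
  interpret matched_bicyclic M "E - M" by (rule M)
  have E: "M \<union> (E - M) = E" using M(2) by auto
  have \<chi>: "sum_connectivity E = weight M (E - M)" using sum_connectivity_eq_weight E by simp
  have bound: "(real m + 1) / sqrt (real m + 4) + 1 / sqrt (real m + 3) + (real m - 3) / sqrt 3 + 1 = bd m"
    by (simp add: bd_def isq_def)
  show ?thesis
  proof (cases "\<exists>c. \<forall>e\<in>E - M. c \<in> e")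
    case True
    then show ?thesis
      unfolding bound \<chi> using weight_star star_isomorphic_B M(3,4) E assms(1) by auto
  next
    case False
    then have "\<not> graph_iso V E (B_verts (2 * m) m) (B_edges (2 * m) m)"
      using star_if_isomorphic_B M(3,4) E assms(1) by auto
    moreover have "bd m < weight M (E - M)" using weight_not_star[OF M(1)] False M(4) assms(1) by auto
    ultimately show ?thesis unfolding bound \<chi> by simp
  qed
qed

end
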